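(* Let $\widetilde{G}$ be a mixed graph with underlying graph $G$. Then $$-2d(G)\leqslant rk(\widetilde{G})-r(G)\leqslant 2d(G).$$
   Context: All graphs are finite, simple, without loops or multiple edges. A mixed graph $\widetilde{G}$ is obtained from a simple graph $G$ (its underlying graph) by orienting some of its edges; undirected edges are written $\{u,v\}$ and arcs $(u,v)$. The Hermitian adjacency matrix $H(\widetilde{G})=(h_{uv})$ is the $n\times n$ matrix with $h_{uv}=1$ if $\{u,v\}$ is an undirected edge, $h_{uv}=i$ if $(u,v)$ is an arc, $h_{uv}=-i$ if $(v,u)$ is an arc, and $h_{uv}=0$ otherwise. The $H$-rank $rk(\widetilde{G})$ is the rank of $H(\widetilde{G})$, and $r(G)$ is the rank of the adjacency matrix $A(G)$. $d(G)=|E_G|-|V_G|+\omega(G)$, where $\omega(G)$ is the number of connected components of $G$ (the dimension of the cycle space). *)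

theory Defs
  imports "HOL-Analysis.Analysis"
begin

text \<open>
  Graphs have the finite type \<^typ>\<open>'v\<close> as vertex set. A simple graph is given by its edge set,
  a set of two-element sets of vertices.
\<close>

definition simple_graph :: "'v::finite set set \<Rightarrow> bool" where
  "simple_graph E \<longleftrightarrow> (\<forall>e\<in>E. card e = 2)"

text \<open>
  A mixed graph is its underlying graph \<open>E\<close> together with the set \<open>A\<close> of arcs obtained by orienting
  some of the edges. The edges without an orientation in \<open>A\<close> are the undirected ones.
\<close>

definition mixed_graph :: "'v::finite set set \<Rightarrow> ('v \<times> 'v) set \<Rightarrow> bool" where
  "mixed_graph E A \<longleftrightarrow>
     simple_graph E \<and> (\<forall>(u, v)\<in>A. {u, v} \<in> E \<and> (v, u) \<notin> A)"

definition undirected_edges :: "'v::finite set set \<Rightarrow> ('v \<times> 'v) set \<Rightarrow> 'v set set" where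
  "undirected_edges E A = E - {{u, v} | u v. (u, v) \<in> A}"

definition adjacency_matrix :: "'v::finite set set \<Rightarrow> real^'v^'v" where
  "adjacency_matrix E = (\<chi> u v. if {u, v} \<in> E then 1 else 0)"

definition hermitian_adjacency_matrix ::
    "'v::finite set set \<Rightarrow> ('v \<times> 'v) set \<Rightarrow> complex^'v^'v" where
  "hermitian_adjacency_matrix E A =
     (\<chi> u v. if {u, v} \<in> undirected_edges E A then 1
             else if (u, v) \<in> A then \<i>
             else if (v, u) \<in> A then - \<i>
             else 0)"

definition H_rank :: "'v::finite set set \<Rightarrow> ('v \<times> 'v) set \<Rightarrow> nat" where
  "H_rank E A = rank (hermitian_adjacency_matrix E A)"

definition graph_rank :: "'v::finite set set \<Rightarrow> nat" where
  "graph_rank E = rank (adjacency_matrix E)"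

definition graph_components :: "'v::finite set set \<Rightarrow> 'v set set" where
  "graph_components E = UNIV // {(u, v). {u, v} \<in> E}\<^sup>*"

definition cycle_space_dim :: "'v::finite set set \<Rightarrow> int" where
  "cycle_space_dim E = int (card E) - int CARD('v) + int (card (graph_components E))"

end

theory Submission
  imports Defs
begin

text \<open>
  Switching by a diagonal unitary matrix does not change the rank. On a spanning forest the
  switching can be chosen so that the Hermitian adjacency matrix agrees with the ordinary one there.
  The two matrices then differ only at the \<open>d(G)\<close> edges outside the forest, hence only in at most
  \<open>2 d(G)\<close> rows, and changing one row changes the rank by at most one. The forest is not made
  explicit: adding the edges one by one, an edge either closes a cycle and is declared exceptional,
  or joins two components, and then the switching is rescaled on one of them.
\<close>

section \<open>Rank of matrices\<close>

lemma vec_dim_Un_le: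
  fixes S T :: "('a::field^'n) set"
  assumes "finite T"
  shows "vec.dim (S \<union> T) \<le> vec.dim S + card T"
  using assms
proof (induction T rule: finite_induct)
  case (insert x T)
  then show ?case by (simp add: vec.dim_insert)
qed simp

text \<open>Outside \<open>W\<close>, row \<open>p\<close> of \<open>M\<close> is \<open>a p\<close>
  times the image of row \<open>p\<close> of \<open>N\<close> under the linear map scaling
  coordinate \<open>q\<close> by \<open>b q\<close>. A linear map does not raise the dimension of
  the span of the rows, and the rows in \<open>W\<close> add at most one dimension each.\<close>

lemma rank_le_if_rows_proportional:
  fixes M N :: "'a::field^'n^'m::finite"
  assumes "\<And>p q. p \<notin> W \<Longrightarrow> M $ p $ q = a p * b q * N $ p $ q"
  shows "rank M \<le> rank N + card W"
proof -
  define f :: "'a^'n \<Rightarrow> 'a^'n" where "f x = (\<chi> q. b q * x $ q)" for x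
  have lin: "Vector_Spaces.linear (*s) (*s) f"
    by unfold_locales (auto simp: f_def vec_eq_iff algebra_simps)
  have "rows M \<subseteq> vec.span (f ` rows N \<union> (\<lambda>p. row p M) ` W)"
  proof
    fix x assume "x \<in> rows M"
    then obtain p where x: "x = row p M" by (auto simp: rows_def)
    show "x \<in> vec.span (f ` rows N \<union> (\<lambda>p. row p M) ` W)"
    proof (cases "p \<in> W")
      case True
      then show ?thesis unfolding x by (intro vec.span_base) auto
    next
      case False
      have "x = a p *s f (row p N)"
        using assms[OF False] by (simp add: x f_def row_def vec_eq_iff mult.assoc)
      moreover have "f (row p N) \<in> f ` rows N" by (auto simp: rows_def)
      ultimately show ?thesis by (simp add: vec.span_scale vec.span_base)
    qed
  qed
  then have "rank M \<le> vec.dim (f ` rows N \<union> (\<lambda>p. row p M) ` W)"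
    unfolding row_rank_def_gen by (rule vec.dim_mono)
  also have "\<dots> \<le> vec.dim (f ` rows N) + card ((\<lambda>p. row p M) ` W)"
    by (rule vec_dim_Un_le) simp
  also have "\<dots> \<le> rank N + card W"
    unfolding row_rank_def_gen
    by (intro add_mono card_image_le vec.dim_image_le[OF lin]) simp
  finally show ?thesis .
qed

text \<open>Makes the real adjacency matrix comparable with the complex Hermitian one. Real vectors
  independent over the reals stay independent over the complex numbers: real and imaginary parts of
  a vanishing complex combination are vanishing real combinations. So a basis of the real row space
  is carried to one of the complex row space.\<close>

lemma rank_of_real_matrix:
  fixes N :: "real^'n^'m"
  shows "rank (\<chi> p q. complex_of_real (N $ p $ q)) = rank N"
proof -
  define f :: "real^'n \<Rightarrow> complex^'n" where "f x = (\<chi> q. complex_of_real (x $ q))" for x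
  define M where "M = (\<chi> p q. complex_of_real (N $ p $ q))"
  have f_sum: "f (\<Sum>v\<in>B. c v *s v) = (\<Sum>v\<in>B. of_real (c v) *s f v)" for B c
    by (simp add: f_def vec_eq_iff)
  have inj: "inj f" by (auto simp: f_def inj_def vec_eq_iff)
  have "row p M = f (row p N)" for p by (simp add: M_def f_def row_def vec_eq_iff)
  then have rows: "rows M = f ` rows N" unfolding rows_def by auto
  obtain B where B: "B \<subseteq> rows N" "vec.independent B" "rows N \<subseteq> vec.span B"
      "card B = vec.dim (rows N)"
    by (rule vec.basis_exists)
  have fin: "finite B" using B(2) by (rule vec.finiteI_independent)
  have "vec.independent (f ` B)"
  proof (rule vec.independent_if_scalars_zero)
    fix c x assume sum0: "(\<Sum>x\<in>f ` B. c x *s x) = 0" and "x \<in> f ` B"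
    then obtain v where v: "v \<in> B" "x = f v" by auto
    have *: "(\<Sum>w\<in>B. c (f w) *s f w) = 0"
      using sum0 inj by (subst (asm) sum.reindex) (auto intro: inj_on_subset)
    have **: "(\<Sum>w\<in>B. c (f w) * of_real (w $ q)) = 0" for q
      using arg_cong[OF *, of "\<lambda>z. z $ q"] by (simp add: f_def)
    have "(\<Sum>w\<in>B. Re (c (f w)) *s w) = 0"
      using arg_cong[OF **, of Re] by (simp add: vec_eq_iff)
    moreover have "(\<Sum>w\<in>B. Im (c (f w)) *s w) = 0"
      using arg_cong[OF **, of Im] by (simp add: vec_eq_iff)
    ultimately have "Re (c (f v)) = 0" "Im (c (f v)) = 0"
      using B(2) v(1) unfolding vec.independent_explicit[of B] by metis+
    then show "c x = 0" by (simp add: v complex_eq_iff)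
  qed (use fin in simp)
  moreover have "f ` rows N \<subseteq> vec.span (f ` B)"
  proof clarify
    fix x assume "x \<in> rows N"
    then obtain c where "x = (\<Sum>v\<in>B. c v *s v)"
      using B(3) vec.span_finite[OF fin] by auto
    then show "f x \<in> vec.span (f ` B)"
      by (simp add: f_sum vec.span_sum vec.span_scale vec.span_base)
  qed
  ultimately have "vec.dim (rows M) = card (f ` B)"
    unfolding rows using B(1) by (intro vec.dim_unique[of "f ` B"]) auto
  also have "\<dots> = card B" using inj by (intro card_image) (auto intro: inj_on_subset)
  finally show ?thesis using B(4) by (simp add: row_rank_def_gen M_def)
qed

section \<open>Components and the cycle space dimension\<close>

definition adjacency_rel :: "'v set set \<Rightarrow> ('v \<times> 'v) set" where
  "adjacency_rel E = {(u, v). {u, v} \<in> E}"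

lemma adjacency_rel_insert:
  "adjacency_rel (insert {u, v} E) = insert (u, v) (insert (v, u) (adjacency_rel E))"
  by (auto simp: adjacency_rel_def doubleton_eq_iff)

lemma equiv_reachable: "equiv UNIV ((adjacency_rel E)\<^sup>*)"
  by (intro equivI sym_rtrancl)
    (auto simp: adjacency_rel_def sym_def insert_commute refl_on_def intro: trans_rtrancl)

lemma reachable_sym: "(x, y) \<in> (adjacency_rel E)\<^sup>* \<Longrightarrow> (y, x) \<in> (adjacency_rel E)\<^sup>*"
  using equiv_reachable[of E] by (meson equivE symD)

lemma cycle_space_dim_empty: "cycle_space_dim ({} :: 'v::finite set set) = 0"
proof -
  have "graph_components ({} :: 'v set set) = (\<lambda>x. {x}) ` UNIV"
    by (auto simp: graph_components_def quotient_def)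
  then show ?thesis by (simp add: cycle_space_dim_def card_image inj_on_def)
qed

text \<open>The ends are already connected, so the components stay the same while the edge count
  grows by one.\<close>

lemma cycle_space_dim_insert_closing:
  fixes E :: "'v::finite set set"
  assumes "{u, v} \<notin> E" "(u, v) \<in> (adjacency_rel E)\<^sup>*"
  shows "cycle_space_dim (insert {u, v} E) = cycle_space_dim E + 1"
proof -
  have "(v, u) \<in> (adjacency_rel E)\<^sup>*"
    using assms(2) by (rule reachable_sym)
  with assms(2) have "(adjacency_rel (insert {u, v} E))\<^sup>* = (adjacency_rel E)\<^sup>*"
    unfolding adjacency_rel_insert by (intro rtrancl_subset) auto
  then have "graph_components (insert {u, v} E) = graph_components E"
    by (simp add: graph_components_def adjacency_rel_def)
  then show ?thesis using assms(1) by (simp add: cycle_space_dim_def)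
qed

text \<open>An edge merges at most two components, and this loss of one is offset by the edge
  itself.\<close>

lemma cycle_space_dim_insert_le:
  fixes E :: "'v::finite set set"
  assumes "{u, v} \<notin> E"
  shows "cycle_space_dim E \<le> cycle_space_dim (insert {u, v} E)"
proof -
  let ?R = "(adjacency_rel E)\<^sup>*" and ?R' = "(adjacency_rel (insert {u, v} E))\<^sup>*"
  have eq: "equiv UNIV ?R" "equiv UNIV ?R'" by (rule equiv_reachable)+
  have sub: "?R \<subseteq> ?R'" unfolding adjacency_rel_insert by (intro rtrancl_mono) auto
  \<comment> \<open>If a path from \<open>x\<close> to \<open>y\<close> uses the new edge, its
    pieces before the first and after the last use tie each of \<open>x\<close> and \<open>y\<close>
    to \<open>u\<close> or \<open>v\<close> in the old graph. If neither is tied to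
    \<open>v\<close>, both are tied to \<open>u\<close>, hence to each other.\<close>
  have R': "(x, y) \<in> ?R \<or> (v, x) \<in> ?R \<or> (v, y) \<in> ?R" if "(x, y) \<in> ?R'" for x y
    using that unfolding adjacency_rel_insert rtrancl_insert
    by (auto intro: reachable_sym rtrancl_trans)
  have image: "?R' `` (?R `` {x}) = ?R' `` {x}" for x
    using sub by (auto intro: rtrancl_trans)
  \<comment> \<open>Any merging involves the old class of \<open>v\<close>. With that class set
    aside, old classes map injectively to the new ones containing them.\<close>
  have inj: "inj_on (\<lambda>X. ?R' `` X) (UNIV // ?R - {?R `` {v}})"
  proof (rule inj_onI)
    fix X Y assume X: "X \<in> UNIV // ?R - {?R `` {v}}" and Y: "Y \<in> UNIV // ?R - {?R `` {v}}"
      and XY: "?R' `` X = ?R' `` Y"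
    obtain x y where xy: "X = ?R `` {x}" "Y = ?R `` {y}" using X Y by (auto elim!: quotientE)
    have "(x, y) \<in> ?R'" using XY unfolding xy image by auto
    moreover have "(v, x) \<notin> ?R" "(v, y) \<notin> ?R"
      using X Y xy equiv_class_eq[OF eq(1)] by blast+
    ultimately have "(x, y) \<in> ?R" using R' by blast
    then show "X = Y" unfolding xy by (rule equiv_class_eq[OF eq(1)])
  qed
  have "card (UNIV // ?R - {?R `` {v}}) \<le> card (UNIV // ?R')"
    by (rule card_inj_on_le[OF inj]) (auto simp: image elim!: quotientE intro!: quotientI)
  then have "card (UNIV // ?R) \<le> card (UNIV // ?R') + 1"
    by (simp add: card_Diff_singleton_if split: if_splits)
  then show ?thesis
    using assms by (simp add: cycle_space_dim_def graph_components_def adjacency_rel_def)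
qed

section \<open>Switching\<close>

text \<open>\<open>g\<close> is the diagonal of the switching matrix and \<open>S\<close> collects
  the exceptional edges. Weights \<open>h\<close> are arbitrary Hermitian ones of modulus one, so
  that they stay fixed while the induction varies \<open>E\<close>.\<close>

lemma exists_switching:
  fixes E :: "'v::finite set set" and h :: "'v \<Rightarrow> 'v \<Rightarrow> complex"
  assumes "simple_graph E"
    and "\<And>p q. {p, q} \<in> E \<Longrightarrow> norm (h p q) = 1"
    and "\<And>p q. {p, q} \<in> E \<Longrightarrow> h q p = cnj (h p q)"
  shows "\<exists>g S. S \<subseteq> E \<and> int (card S) \<le> cycle_space_dim E \<and> (\<forall>p. norm (g p) = 1) \<and>
           (\<forall>p q. {p, q} \<in> E - S \<longrightarrow> h p q = g p * cnj (g q))"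
  using finite[of E] assms
proof (induction E rule: finite_induct)
  case empty
  show ?case by (intro exI[of _ "\<lambda>_. 1"] exI[of _ "{}"]) (simp add: cycle_space_dim_empty)
next
  case (insert e E)
  from insert.prems(1) obtain u v where e: "e = {u, v}"
    by (auto simp: simple_graph_def card_2_iff)
  have huv: "norm (h u v) = 1" "h v u = cnj (h u v)"
    by (rule insert.prems; simp add: e)+
  have "simple_graph E" using insert.prems(1) by (simp add: simple_graph_def)
  then obtain g S where S: "S \<subseteq> E" "int (card S) \<le> cycle_space_dim E"
    and g: "\<And>p. norm (g p) = 1"
    and gh: "\<And>p q. {p, q} \<in> E - S \<Longrightarrow> h p q = g p * cnj (g q)"
    using insert.IH insert.prems(2,3) by (metis insertCI)
  have gg: "g p * cnj (g p) = 1" for p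
    using g[of p] by (simp add: complex_norm_square[symmetric])
  show ?case
  proof (cases "(u, v) \<in> (adjacency_rel E)\<^sup>*")
    case True
    have "e \<notin> S" using S insert.hyps by auto
    then have "int (card (insert e S)) \<le> cycle_space_dim (insert e E)"
      using S insert.hyps True e by (simp add: cycle_space_dim_insert_closing)
    then show ?thesis
      using S g gh by (intro exI[of _ g] exI[of _ "insert e S"]) auto
  next
    case False
    define C where "C = (adjacency_rel E)\<^sup>* `` {v}"
    \<comment> \<open>The solution of \<open>h u v = g u * cnj (c * g v)\<close>, given that
      \<open>g u\<close> and \<open>g v\<close> have modulus one.\<close>
    define c where "c = cnj (h u v) * g u * cnj (g v)"
    define g' where "g' p = (if p \<in> C then c * g p else g p)" for p
    have uv: "v \<in> C" "u \<notin> C"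
      using False by (auto simp: C_def dest: reachable_sym)
    have C: "p \<in> C \<longleftrightarrow> q \<in> C" if "{p, q} \<in> E" for p q
    proof -
      have "(p, q) \<in> adjacency_rel E" "(q, p) \<in> adjacency_rel E"
        using that by (simp_all add: adjacency_rel_def insert_commute)
      then show ?thesis by (auto simp: C_def intro: rtrancl_into_rtrancl)
    qed
    have c: "norm c = 1" using g huv by (simp add: c_def norm_mult)
    then have cc: "c * cnj c = 1" by (simp add: complex_norm_square[symmetric])
    have g'_uv: "h u v = g' u * cnj (g' v)"
    proof -
      have "g' u * cnj (g' v) = h u v * (g u * cnj (g u)) * (g v * cnj (g v))"
        using uv by (simp add: g'_def c_def)
      then show ?thesis by (simp add: gg)
    qed
    have "h p q = g' p * cnj (g' q)" if pq: "{p, q} \<in> insert e E - S" for p q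
    proof (cases "{p, q} = e")
      case True
      then consider "p = u" "q = v" | "p = v" "q = u" by (auto simp: e doubleton_eq_iff)
      then show ?thesis using g'_uv huv(2) by cases simp_all
    next
      case False
      then have "{p, q} \<in> E - S" using pq by auto
      \<comment> \<open>An old edge has both ends in \<open>C\<close> or neither, so
        \<open>c\<close> cancels against its conjugate or does not occur.\<close>
      moreover have "g' p * cnj (g' q) = g p * cnj (g q)"
      proof (cases "p \<in> C")
        case True
        then have "g' p * cnj (g' q) = (c * cnj c) * (g p * cnj (g q))"
          using C[of p q] \<open>{p, q} \<in> E - S\<close> by (simp add: g'_def)
        then show ?thesis by (simp add: cc)
      next
        case False
        then show ?thesis using C[of p q] \<open>{p, q} \<in> E - S\<close> by (simp add: g'_def)
      qed
      ultimately show ?thesis using gh by simp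
    qed
    moreover have "norm (g' p) = 1" for p using g c by (simp add: g'_def norm_mult)
    moreover have "int (card S) \<le> cycle_space_dim (insert e E)"
      using S(2) cycle_space_dim_insert_le insert.hyps(2) e by fastforce
    ultimately show ?thesis
      using S(1) by (intro exI[of _ g'] exI[of _ S]) auto
  qed
qed

lemma card_Union_simple_graph_le:
  assumes "simple_graph E"
  shows "card (\<Union>E) \<le> 2 * card E"
proof -
  have "card (\<Union>E) \<le> (\<Sum>e\<in>E. card e)" by (rule card_Union_le_sum_card)
  also have "\<dots> = 2 * card E" using assms by (simp add: simple_graph_def)
  finally show ?thesis .
qed

text \<open>Provides the hypotheses of \<open>exists_switching\<close>. Since no edge is oriented
  both ways, an entry \<open>\<i>\<close> always faces \<open>- \<i>\<close>.\<close>

lemma hermitian_adjacency_matrix_edge: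
  assumes "mixed_graph E A" "{p, q} \<in> E"
  shows "norm (hermitian_adjacency_matrix E A $ p $ q) = 1"
    and "hermitian_adjacency_matrix E A $ q $ p = cnj (hermitian_adjacency_matrix E A $ p $ q)"
  using assms
  by (auto simp: hermitian_adjacency_matrix_def undirected_edges_def mixed_graph_def
      doubleton_eq_iff insert_commute)

lemma hermitian_adjacency_matrix_nonedge:
  assumes "mixed_graph E A" "{p, q} \<notin> E"
  shows "hermitian_adjacency_matrix E A $ p $ q = 0"
  using assms
  by (auto simp: hermitian_adjacency_matrix_def undirected_edges_def mixed_graph_def
      insert_commute)

theorem theorem1p1:
  fixes E :: "'v::finite set set" and A :: "('v \<times> 'v) set"
  assumes "mixed_graph E A"
  shows "- 2 * cycle_space_dim E \<le> int (H_rank E A) - int (graph_rank E) \<and>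
         int (H_rank E A) - int (graph_rank E) \<le> 2 * cycle_space_dim E"
proof -
  define H where "H = hermitian_adjacency_matrix E A"
  define N :: "complex^'v^'v" where "N = (\<chi> p q. of_real (adjacency_matrix E $ p $ q))"
  have simple: "simple_graph E" using assms by (simp add: mixed_graph_def)
  obtain g S where S: "S \<subseteq> E" "int (card S) \<le> cycle_space_dim E"
    and g: "\<And>p. norm (g p) = 1"
    and gh: "\<And>p q. {p, q} \<in> E - S \<Longrightarrow> H $ p $ q = g p * cnj (g q)"
    using exists_switching[OF simple, of "\<lambda>p q. H $ p $ q"]
      hermitian_adjacency_matrix_edge[OF assms] unfolding H_def by blast
  have gg: "cnj (g p) * g p = 1" for p
    using g[of p] by (simp add: complex_norm_square[symmetric] mult.commute)
  have HN: "H $ p $ q = g p * cnj (g q) * N $ p $ q" if "p \<notin> \<Union>S" for p q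
  proof (cases "{p, q} \<in> E")
    case True
    then show ?thesis using gh[of p q] that by (auto simp: N_def adjacency_matrix_def)
  next
    case False
    then show ?thesis
      using hermitian_adjacency_matrix_nonedge[OF assms False]
      by (simp add: H_def N_def adjacency_matrix_def)
  qed
  \<comment> \<open>The diagonal entries have modulus one, so conjugating them inverts the
    switching. This gives the rank inequality in the opposite direction.\<close>
  have NH: "N $ p $ q = cnj (g p) * g q * H $ p $ q" if "p \<notin> \<Union>S" for p q
  proof -
    have "cnj (g p) * g q * H $ p $ q = (cnj (g p) * g p) * (cnj (g q) * g q) * N $ p $ q"
      unfolding HN[OF that] by (simp add: mult_ac)
    then show ?thesis by (simp add: gg)
  qed
  \<comment> \<open>The exceptional rows are those indexed by the ends of the edges in
    \<open>S\<close>, two ends per edge; hence the factor 2 in the bound.\<close>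
  have "rank H \<le> rank N + card (\<Union>S)" "rank N \<le> rank H + card (\<Union>S)"
    by (rule rank_le_if_rows_proportional, erule HN NH)+
  moreover have "card (\<Union>S) \<le> 2 * card S"
    using simple S(1) by (intro card_Union_simple_graph_le) (auto simp: simple_graph_def)
  moreover have "rank H = H_rank E A" "rank N = graph_rank E"
    by (simp_all add: H_def N_def H_rank_def graph_rank_def rank_of_real_matrix)
  ultimately show ?thesis using S(2) by linarith
qed

end
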